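(* Let $d\ge1$ and let $b=(b_m)_{m\in\mathbb{Z}^d}$ be a nonnegative function in $\ell^1(\mathbb{Z}^d)$, that is, $b_m\ge0$ for all $m\in\mathbb{Z}^d$ and $\sum_{m}b_m<\infty$. For any finitely supported $\delta=(\delta_k)_{k\in\mathbb{Z}^d}\in\ell^2(\mathbb{Z}^d)$ (real-valued), define $$Q(\delta):=\sum_{k,\ell\in\mathbb{Z}^d}\delta_k\,\delta_\ell\,b_{\ell-k}.$$ Then $$\sup_{\delta\neq0}\frac{Q(\delta)}{\|\delta\|_2^2}=\|b\|_1,$$ the supremum being over nonzero finitely supported $\delta$. Moreover, if $\delta^{(L)}=\mathbf 1_{\Lambda_L}$ with $\Lambda_L:=[-L,L]^d\cap\mathbb{Z}^d$, then $$\frac{Q(\delta^{(L)})}{\|\delta^{(L)}\|_2^2}\longrightarrow\|b\|_1\qquad\text{as }L\to\infty.$$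
   Context: $\|b\|_1=\sum_m b_m$ and $\|\delta\|_2^2=\sum_k\delta_k^2$. *)

theory Defs
  imports "HOL-Analysis.Analysis"
begin

text \<open>
  The lattice of dimension \<open>d \<ge> 1\<close> is the type \<open>int ^ 'd\<close> with \<open>d = CARD('d)\<close>.
  The sums over the lattice below are unordered; for finitely supported \<open>\<delta>\<close>
  those in \<open>quad_form\<close> and \<open>l2_norm_sq\<close> have only finitely many nonzero terms.
\<close>

definition finitely_supported :: "('a \<Rightarrow> real) \<Rightarrow> bool" where
  "finitely_supported \<delta> \<longleftrightarrow> finite {k. \<delta> k \<noteq> 0}"

definition quad_form :: "(int ^ 'd \<Rightarrow> real) \<Rightarrow> (int ^ 'd \<Rightarrow> real) \<Rightarrow> real" where
  "quad_form b \<delta> = (\<Sum>\<^sub>\<infinity>(k, l)\<in>UNIV. \<delta> k * \<delta> l * b (l - k))"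

definition l2_norm_sq :: "('a \<Rightarrow> real) \<Rightarrow> real" where
  "l2_norm_sq \<delta> = (\<Sum>\<^sub>\<infinity>k\<in>UNIV. (\<delta> k)\<^sup>2)"

definition rayleigh_quotient :: "(int ^ 'd \<Rightarrow> real) \<Rightarrow> (int ^ 'd \<Rightarrow> real) \<Rightarrow> real" where
  "rayleigh_quotient b \<delta> = quad_form b \<delta> / l2_norm_sq \<delta>"

definition lattice_box :: "nat \<Rightarrow> (int ^ 'd) set" where
  "lattice_box L = {m. \<forall>i. m $ i \<in> {- int L..int L}}"

end

theory Submission
  imports Defs "HOL-Real_Asymp.Real_Asymp"
begin

text \<open>
  The inequality \<open>\<delta>\<^sub>k \<delta>\<^sub>l \<le> (\<delta>\<^sub>k\<^sup>2 + \<delta>\<^sub>l\<^sup>2) / 2\<close> together with the fact that every row and column sum of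
  \<open>b (l - k)\<close> is at most \<open>\<parallel>b\<parallel>\<^sub>1\<close> bounds the Rayleigh quotient by \<open>\<parallel>b\<parallel>\<^sub>1\<close> (Schur's test).
  Conversely, let \<open>F\<close> be a finite set inside the box of radius \<open>M\<close>. Every \<open>k\<close> in the box of radius
  \<open>L\<close> sees the whole translate \<open>k + F\<close> inside the box of radius \<open>L + M\<close>, so the quotient of the
  latter box is at least \<open>((2 L + 1) / (2 (L + M) + 1))\<^sup>d\<close> times the sum of \<open>b\<close> over \<open>F\<close>.
\<close>

lemma l2_norm_sq_finite:
  assumes "finite S" "\<And>k. k \<notin> S \<Longrightarrow> \<delta> k = 0"
  shows "l2_norm_sq \<delta> = (\<Sum>k\<in>S. (\<delta> k)\<^sup>2)"
proof -
  have "l2_norm_sq \<delta> = (\<Sum>\<^sub>\<infinity>k\<in>S. (\<delta> k)\<^sup>2)"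
    unfolding l2_norm_sq_def using assms(2) by (intro infsum_cong_neutral) auto
  then show ?thesis using assms(1) by simp
qed

lemma quad_form_finite:
  assumes "finite S" "\<And>k. k \<notin> S \<Longrightarrow> \<delta> k = 0"
  shows "quad_form b \<delta> = (\<Sum>k\<in>S. \<Sum>l\<in>S. \<delta> k * \<delta> l * b (l - k))"
proof -
  have "quad_form b \<delta> = (\<Sum>\<^sub>\<infinity>(k, l)\<in>S \<times> S. \<delta> k * \<delta> l * b (l - k))"
    unfolding quad_form_def using assms(2) by (intro infsum_cong_neutral) force+
  then show ?thesis using assms(1) by (simp add: sum.cartesian_product)
qed

lemma l2_norm_sq_pos:
  assumes "finitely_supported \<delta>" "\<delta> \<noteq> (\<lambda>_. 0)"
  shows "l2_norm_sq \<delta> > 0"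
proof -
  let ?S = "{k. \<delta> k \<noteq> 0}"
  have "(\<Sum>k\<in>?S. (\<delta> k)\<^sup>2) > 0"
    using assms by (intro sum_pos) (auto simp: finitely_supported_def)
  also have "(\<Sum>k\<in>?S. (\<delta> k)\<^sup>2) = l2_norm_sq \<delta>"
    using assms(1) by (intro l2_norm_sq_finite[symmetric]) (auto simp: finitely_supported_def)
  finally show ?thesis .
qed

text \<open>Serves both halves of Schur's test: for fixed \<open>k\<close> the map
  \<open>l - k\<close> is injective in \<open>l\<close>, and for fixed \<open>l\<close> it is
  injective in \<open>k\<close>, so each row or column sum is a finite partial sum of the
  nonnegative \<open>b\<close>.\<close>

lemma sum_inj_le_infsum:
  fixes b :: "'a \<Rightarrow> real"
  assumes "\<And>m. b m \<ge> 0" "b summable_on UNIV" "finite S" "inj_on f S"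
  shows "(\<Sum>l\<in>S. b (f l)) \<le> (\<Sum>\<^sub>\<infinity>m. b m)"
proof -
  have "(\<Sum>l\<in>S. b (f l)) = sum b (f ` S)"
    using assms(4) by (simp add: sum.reindex)
  also have "\<dots> \<le> (\<Sum>\<^sub>\<infinity>m. b m)"
    using assms by (intro finite_sum_le_infsum) auto
  finally show ?thesis .
qed

lemma quad_form_le:
  fixes b :: "int ^ 'd \<Rightarrow> real"
  assumes nonneg: "\<And>m. b m \<ge> 0" and summable: "b summable_on UNIV"
    and "finitely_supported \<delta>"
  shows "quad_form b \<delta> \<le> (\<Sum>\<^sub>\<infinity>m. b m) * l2_norm_sq \<delta>"
proof -
  define S where "S = {k. \<delta> k \<noteq> 0}"
  have S: "finite S" "\<And>k. k \<notin> S \<Longrightarrow> \<delta> k = 0"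
    using assms(3) by (auto simp: S_def finitely_supported_def)
  let ?B = "\<Sum>\<^sub>\<infinity>m. b m" and ?w = "\<lambda>k. (\<delta> k)\<^sup>2 / 2"
  have row: "(\<Sum>l\<in>S. b (l - k)) \<le> ?B" for k
    by (intro sum_inj_le_infsum assms S) (auto intro: inj_onI)
  have col: "(\<Sum>k\<in>S. b (l - k)) \<le> ?B" for l
    by (intro sum_inj_le_infsum assms S) (auto intro: inj_onI)
  have "quad_form b \<delta> = (\<Sum>k\<in>S. \<Sum>l\<in>S. \<delta> k * \<delta> l * b (l - k))"
    using S by (rule quad_form_finite)
  also have "\<dots> \<le> (\<Sum>k\<in>S. \<Sum>l\<in>S. (?w k + ?w l) * b (l - k))"
  proof (intro sum_mono mult_right_mono nonneg)
    fix k l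
    show "\<delta> k * \<delta> l \<le> ?w k + ?w l"
      using sum_squares_bound[of "\<delta> k" "\<delta> l"] by simp
  qed
  also have "\<dots> = (\<Sum>k\<in>S. \<Sum>l\<in>S. ?w k * b (l - k)) + (\<Sum>k\<in>S. \<Sum>l\<in>S. ?w l * b (l - k))"
    by (simp add: distrib_right sum.distrib)
  \<comment> \<open>The weight \<open>?w l\<close> must be constant in the inner sum, so that only a
    column sum of \<open>b\<close> remains there. Rows and columns then contribute half of the bound
    each.\<close>
  also have "(\<Sum>k\<in>S. \<Sum>l\<in>S. ?w l * b (l - k)) = (\<Sum>l\<in>S. \<Sum>k\<in>S. ?w l * b (l - k))"
    by (rule sum.swap)
  also have "(\<Sum>k\<in>S. \<Sum>l\<in>S. ?w k * b (l - k)) + (\<Sum>l\<in>S. \<Sum>k\<in>S. ?w l * b (l - k))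
      \<le> (\<Sum>k\<in>S. ?w k * ?B) + (\<Sum>l\<in>S. ?w l * ?B)"
    unfolding sum_distrib_left[symmetric]
    by (intro add_mono sum_mono mult_left_mono row col) auto
  also have "\<dots> = ?B * l2_norm_sq \<delta>"
    using S by (simp add: l2_norm_sq_finite[of S] sum_divide_distrib[symmetric]
        sum_distrib_right[symmetric])
  finally show ?thesis .
qed

lemma rayleigh_quotient_le:
  fixes b :: "int ^ 'd \<Rightarrow> real"
  assumes "\<And>m. b m \<ge> 0" "b summable_on UNIV" "finitely_supported \<delta>" "\<delta> \<noteq> (\<lambda>_. 0)"
  shows "rayleigh_quotient b \<delta> \<le> (\<Sum>\<^sub>\<infinity>m. b m)"
  unfolding rayleigh_quotient_def
  using quad_form_le[OF assms(1-3)] l2_norm_sq_pos[OF assms(3,4)]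
  by (simp add: pos_divide_le_eq)

text \<open>Over the full index type the extensionality in \<open>\<rightarrow>\<^sub>E\<close> is
  vacuous. Finiteness and cardinality of boxes thus reduce to those of \<open>PiE\<close>.\<close>

lemma vec_box_eq_image:
  "{m :: 'a ^ 'd. \<forall>i. m $ i \<in> A} = vec_lambda ` (UNIV \<rightarrow>\<^sub>E A)"
proof (intro equalityI subsetI)
  fix m :: "'a ^ 'd" assume "m \<in> {m. \<forall>i. m $ i \<in> A}"
  then have "vec_nth m \<in> UNIV \<rightarrow>\<^sub>E A" by auto
  then have "vec_lambda (vec_nth m) \<in> vec_lambda ` (UNIV \<rightarrow>\<^sub>E A)" by (rule imageI)
  then show "m \<in> vec_lambda ` (UNIV \<rightarrow>\<^sub>E A)" by simp
qed auto

lemma finite_lattice_box: "finite (lattice_box L :: (int ^ 'd) set)"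
  unfolding lattice_box_def vec_box_eq_image by (intro finite_imageI finite_PiE) auto

lemma card_lattice_box: "card (lattice_box L :: (int ^ 'd) set) = (2 * L + 1) ^ CARD('d)"
proof -
  have "inj_on vec_lambda (UNIV \<rightarrow>\<^sub>E {- int L..int L} :: ('d \<Rightarrow> int) set)"
    by (intro inj_onI) (auto simp: vec_lambda_inject)
  then have "card (lattice_box L :: (int ^ 'd) set) = (nat (2 * int L + 1)) ^ CARD('d)"
    unfolding lattice_box_def vec_box_eq_image by (simp add: card_image card_PiE)
  then show ?thesis by (simp add: nat_add_distrib nat_mult_distrib)
qed

lemma finite_subset_lattice_box:
  assumes "finite (F :: (int ^ 'd) set)"
  obtains M where "F \<subseteq> lattice_box M"
proof
  \<comment> \<open>The sum of all absolute coordinates dominates each one of them and, unlike a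
    maximum, needs no separate case for empty \<open>F\<close>.\<close>
  let ?N = "\<Sum>m\<in>F. \<Sum>i\<in>UNIV. nat \<bar>m $ i\<bar>"
  show "F \<subseteq> lattice_box ?N"
  proof
    fix m assume "m \<in> F"
    have "m $ i \<in> {- int ?N..int ?N}" for i
    proof -
      have "nat \<bar>m $ i\<bar> \<le> (\<Sum>i\<in>UNIV. nat \<bar>m $ i\<bar>)"
        by (rule member_le_sum) auto
      also have "\<dots> \<le> ?N"
        using \<open>m \<in> F\<close> assms by (intro member_le_sum[where f = "\<lambda>m. \<Sum>i\<in>UNIV. nat \<bar>m $ i\<bar>"]) auto
      finally have "\<bar>m $ i\<bar> \<le> int ?N" by linarith
      then show ?thesis by (simp only: atLeastAtMost_iff) linarith
    qed
    then show "m \<in> lattice_box ?N" by (simp add: lattice_box_def)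
  qed
qed

lemma lattice_box_add:
  assumes "k \<in> lattice_box L" "m \<in> lattice_box M"
  shows "k + m \<in> lattice_box (L + M)"
proof -
  have "(k + m) $ i \<in> {- int (L + M)..int (L + M)}" for i
  proof -
    have "k $ i \<in> {- int L..int L}" "m $ i \<in> {- int M..int M}"
      using assms unfolding lattice_box_def by blast+
    then show ?thesis by simp
  qed
  then show ?thesis unfolding lattice_box_def by blast
qed

lemma finitely_supported_indicator: "finite A \<Longrightarrow> finitely_supported (indicator A)"
  by (auto simp: finitely_supported_def indicator_def)

lemma indicator_lattice_box_nonzero:
  "(indicator (lattice_box L) :: int ^ 'd \<Rightarrow> real) \<noteq> (\<lambda>_. 0)"
proof
  assume "(indicator (lattice_box L) :: int ^ 'd \<Rightarrow> real) = (\<lambda>_. 0)"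
  \<comment> \<open>The origin lies in every box, also for \<open>L = 0\<close>.\<close>
  then have "(indicator (lattice_box L) (0 :: int ^ 'd) :: real) = 0" by (rule fun_cong)
  then show False by (simp add: lattice_box_def)
qed

lemma rayleigh_quotient_indicator:
  assumes "finite A"
  shows "rayleigh_quotient b (indicator A) = (\<Sum>k\<in>A. \<Sum>l\<in>A. b (l - k)) / card A"
proof -
  have "l2_norm_sq (indicator A) = card A"
    using assms by (subst l2_norm_sq_finite[of A]) auto
  moreover have "quad_form b (indicator A) = (\<Sum>k\<in>A. \<Sum>l\<in>A. b (l - k))"
    using assms by (subst quad_form_finite[of A]) auto
  ultimately show ?thesis by (simp add: rayleigh_quotient_def)
qed

lemma rayleigh_quotient_lattice_box_ge:
  fixes b :: "int ^ 'd \<Rightarrow> real"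
  assumes nonneg: "\<And>m. b m \<ge> 0" and F: "F \<subseteq> lattice_box M"
  shows "((2 * real L + 1) / (2 * real (L + M) + 1)) ^ CARD('d) * sum b F
    \<le> rayleigh_quotient b (indicator (lattice_box (L + M)))"
proof -
  let ?A = "lattice_box L :: (int ^ 'd) set" and ?B = "lattice_box (L + M) :: (int ^ 'd) set"
  have sub: "?A \<subseteq> ?B"
    \<comment> \<open>Adding the origin, a point of the box of radius \<open>M\<close>, gives
      monotonicity of the boxes.\<close>
    using lattice_box_add[of _ L 0 M] by (auto simp: lattice_box_def[of M])
  have row: "sum b F \<le> (\<Sum>l\<in>?B. b (l - k))" if "k \<in> ?A" for k
  proof -
    have "sum b F = (\<Sum>l\<in>(+) k ` F. b (l - k))"
      by (simp add: sum.reindex)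
    also have "\<dots> \<le> (\<Sum>l\<in>?B. b (l - k))"
      using that F by (intro sum_mono2 finite_lattice_box nonneg) (auto intro: lattice_box_add)
    finally show ?thesis .
  qed
  have "card ?A * sum b F = (\<Sum>k\<in>?A. sum b F)" by simp
  also have "\<dots> \<le> (\<Sum>k\<in>?A. \<Sum>l\<in>?B. b (l - k))"
    by (intro sum_mono row)
  \<comment> \<open>The rows with \<open>k\<close> in the boundary layer \<open>?B - ?A\<close> are
    nonnegative, so adding them only increases the sum.\<close>
  also have "\<dots> \<le> (\<Sum>k\<in>?B. \<Sum>l\<in>?B. b (l - k))"
    by (intro sum_mono2 finite_lattice_box sub sum_nonneg nonneg)
  finally have "card ?A * sum b F / card ?B \<le> rayleigh_quotient b (indicator ?B)"
    unfolding rayleigh_quotient_indicator[OF finite_lattice_box]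
    by (intro divide_right_mono) auto
  then show ?thesis
    by (simp add: card_lattice_box power_divide add.commute)
qed

lemma rayleigh_quotient_lattice_box_tendsto:
  fixes b :: "int ^ 'd \<Rightarrow> real"
  assumes nonneg: "\<And>m. b m \<ge> 0" and summable: "b summable_on UNIV"
  shows "(\<lambda>L. rayleigh_quotient b (indicator (lattice_box L))) \<longlonglongrightarrow> (\<Sum>\<^sub>\<infinity>m. b m)"
proof (rule order_tendstoI)
  \<comment> \<open>Lower half: some finite \<open>F\<close> already has \<open>sum b F\<close>
    above \<open>a\<close>. Its radius \<open>M\<close> stays fixed while \<open>L\<close> grows, so
    the volume ratio of the two boxes tends to 1.\<close>
  fix a assume "a < (\<Sum>\<^sub>\<infinity>m. b m)"
  moreover have "(sum b \<longlongrightarrow> (\<Sum>\<^sub>\<infinity>m. b m)) (finite_subsets_at_top UNIV)"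
    using summable by (rule infsum_tendsto)
  ultimately have "\<forall>\<^sub>F F in finite_subsets_at_top UNIV. a < sum b F"
    by (rule order_tendstoD(1)[rotated])
  then obtain F where F: "finite F" "a < sum b F"
    by (auto simp: eventually_finite_subsets_at_top)
  obtain M where M: "F \<subseteq> lattice_box M"
    using finite_subset_lattice_box F(1) .
  have "(\<lambda>L. (2 * real L + 1) / (2 * real (L + M) + 1)) \<longlonglongrightarrow> 1"
    unfolding of_nat_add by real_asymp
  then have "(\<lambda>L. ((2 * real L + 1) / (2 * real (L + M) + 1)) ^ CARD('d) * sum b F)
      \<longlonglongrightarrow> 1 ^ CARD('d) * sum b F"
    by (intro tendsto_intros)
  then have "\<forall>\<^sub>F L in sequentially.
      a < ((2 * real L + 1) / (2 * real (L + M) + 1)) ^ CARD('d) * sum b F"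
    using F(2) by (intro order_tendstoD(1)) auto
  then have "\<forall>\<^sub>F L in sequentially. a < rayleigh_quotient b (indicator (lattice_box (L + M)))"
    by eventually_elim (rule less_le_trans[OF _ rayleigh_quotient_lattice_box_ge[OF nonneg M]])
  \<comment> \<open>A shift of the index by the constant \<open>M\<close> does not affect an
    eventual property.\<close>
  then show "\<forall>\<^sub>F L in sequentially. a < rayleigh_quotient b (indicator (lattice_box L))"
    by (rule eventually_sequentially_seg[THEN iffD1])
\<comment> \<open>Upper half: by Schur's test the bound holds for every \<open>L\<close>, not only
  eventually.\<close>
next
  fix a assume "(\<Sum>\<^sub>\<infinity>m. b m) < a"
  then show "\<forall>\<^sub>F L in sequentially. rayleigh_quotient b (indicator (lattice_box L)) < a"
    by (intro always_eventually allI le_less_trans[OF rayleigh_quotient_le[OF assms]]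
        finitely_supported_indicator finite_lattice_box indicator_lattice_box_nonzero)
qed

text \<open>Boundedness is asserted separately because a real \<open>SUP\<close> is the true
  supremum only for nonempty sets bounded above. The indicators of boxes show that the set is
  nonempty and that the upper bound is approached.\<close>

theorem proposition3p3:
  fixes b :: "int ^ 'd \<Rightarrow> real"
  assumes nonneg: "\<And>m. b m \<ge> 0"
    and summable: "b summable_on UNIV"
  shows "bdd_above (rayleigh_quotient b ` {\<delta>. finitely_supported \<delta> \<and> \<delta> \<noteq> (\<lambda>_. 0)})
    \<and> (SUP \<delta>\<in>{\<delta>. finitely_supported \<delta> \<and> \<delta> \<noteq> (\<lambda>_. 0)}. rayleigh_quotient b \<delta>) = (\<Sum>\<^sub>\<infinity>m. b m)
    \<and> (\<lambda>L. rayleigh_quotient b (indicator (lattice_box L))) \<longlonglongrightarrow> (\<Sum>\<^sub>\<infinity>m. b m)"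
proof -
  let ?D = "{\<delta> :: int ^ 'd \<Rightarrow> real. finitely_supported \<delta> \<and> \<delta> \<noteq> (\<lambda>_. 0)}"
  note lim = rayleigh_quotient_lattice_box_tendsto[OF assms]
  have le: "rayleigh_quotient b \<delta> \<le> (\<Sum>\<^sub>\<infinity>m. b m)" if "\<delta> \<in> ?D" for \<delta>
    using that rayleigh_quotient_le[OF assms] by auto
  have box: "indicator (lattice_box L) \<in> ?D" for L
    by (simp add: finitely_supported_indicator finite_lattice_box indicator_lattice_box_nonzero)
  have bdd: "bdd_above (rayleigh_quotient b ` ?D)"
    using le by (rule bdd_aboveI2)
  have "(SUP \<delta>\<in>?D. rayleigh_quotient b \<delta>) = (\<Sum>\<^sub>\<infinity>m. b m)"
  proof (rule antisym)
    show "(SUP \<delta>\<in>?D. rayleigh_quotient b \<delta>) \<le> (\<Sum>\<^sub>\<infinity>m. b m)"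
      using box le by (intro cSUP_least) blast+
    \<comment> \<open>Every box quotient lies below the supremum, hence so does the limit of these
      quotients.\<close>
    show "(\<Sum>\<^sub>\<infinity>m. b m) \<le> (SUP \<delta>\<in>?D. rayleigh_quotient b \<delta>)"
      using lim by (rule LIMSEQ_le_const2) (intro exI allI impI cSUP_upper box bdd)
  qed
  with bdd lim show ?thesis by blast
qed

end
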